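(* There is a bijection between zero-dimensional tropical ideals of degree $3$ in $\mathbb{B}[x_1^{\pm1},\dots,x_n^{\pm1}]$ and pairs $(L,\mathcal{P})$, where $L$ is a sublattice of $\mathbb{Z}^n$ and $\mathcal{P}$ is a $2$-partition of the quotient group $\mathbb{Z}^n/L$ that is invariant under the action of $\mathbb{Z}^n$. The bijection sends a tropical ideal $I$ to the pair $(L_I,\mathcal{H}(\operatorname{si}(\underline{M}(I))))$.
   Context: $\mathbb{B}=\{\infty,0\}$ with $\oplus=\min$ and multiplication $+$; $\operatorname{supp}(f)$ is the set of exponents with coefficient $\neq\infty$. A tropical ideal $I\subset\mathbb{B}[x_1^{\pm1},\dots,x_n^{\pm1}]$ is an ideal such that for all $f,g\in I$ and $\mathbf u\in\operatorname{supp}(f)\cap\operatorname{supp}(g)$ there is $h\in I$ with $\operatorname{supp}(f)\Delta\operatorname{supp}(g)\subset\operatorname{supp}(h)\subset(\operatorname{supp}(f)\cup\operatorname{supp}(g))\setminus\{\mathbf u\}$. Its underlying matroid $\underline M(I)$ is the finitary matroid on $\mathbb{Z}^n$ whose independent sets are those containing no support of a polynomial in $I$. $I$ is zero-dimensional of degree $r$ iff $\underline M(I)$ has finite rank $r$. The binomial lattice is $L_I=\{\mathbf u-\mathbf v:\mathbf x^{\mathbf u}\oplus\mathbf x^{\mathbf v}\in I\}\cup\{\mathbf 0\}$, a sublattice of $\mathbb{Z}^n$. For a loopless finitary matroid $M$ on $E$, $a\sim b$ (parallel) iff $a=b$ or $\{a,b\}$ is a circuit; the simplification $\operatorname{si}(M)$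 is the matroid on $E/\!\sim$ whose circuits are the sets $\{[a_1],\dots,[a_k]\}$ with $\{a_1,\dots,a_k\}$ a circuit of $M$ (here the parallel classes of $\underline M(I)$ are the cosets of $L_I$). $\mathcal H(M)$ denotes the set of hyperplanes (maximal subsets of rank $\operatorname{rank}(M)-1$). A $2$-partition of a set $E$ is a collection of subsets (blocks) with at least two blocks, every block of size $\ge2$, and every $2$-subset of $E$ in exactly one block. $\mathbb{Z}^n$ acts on $\mathbb{Z}^n/L$ by translation, hence on subsets and on collections of subsets; invariance means fixed by all $\mathbf u\in\mathbb{Z}^n$. *)

theory Defs
  imports "HOL-Analysis.Finite_Cartesian_Product"
begin

text \<open>Exponent lattice Z^n is modelled as the type int ^ 'n ('n a finite index type
  with n = CARD('n)).  A polynomial of the Boolean tropical Laurent ring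
  B[x_1^{+-1},...,x_n^{+-1}] (B = {infinity,0}) is determined by its support, a finite
  subset of Z^n: addition (min) is union of supports, multiplication is the Minkowski
  sum of supports, the zero polynomial (all coefficients infinity) has empty support.
  Hence a set of polynomials is represented by a set of finite subsets of Z^n.\<close>

definition tmult :: "('a::plus) set \<Rightarrow> 'a set \<Rightarrow> 'a set" where
  "tmult A B = {a + b | a b. a \<in> A \<and> b \<in> B}"

definition is_ideal :: "('a::plus) set set \<Rightarrow> bool" where
  "is_ideal I \<longleftrightarrow> I \<noteq> {} \<and> (\<forall>f\<in>I. finite f)
     \<and> (\<forall>f\<in>I. \<forall>g\<in>I. f \<union> g \<in> I)
     \<and> (\<forall>f\<in>I. \<forall>g. finite g \<longrightarrow> tmult g f \<in> I)"

definition tropical_ideal :: "('a::plus) set set \<Rightarrow> bool" where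
  "tropical_ideal I \<longleftrightarrow> is_ideal I \<and>
     (\<forall>f\<in>I. \<forall>g\<in>I. \<forall>u\<in>f \<inter> g. \<exists>h\<in>I.
        (f - g) \<union> (g - f) \<subseteq> h \<and> h \<subseteq> (f \<union> g) - {u})"

text \<open>Underlying matroid, given by its independence predicate: independent sets are
  those containing no support of a nonzero polynomial of I.\<close>
definition ul_indep :: "'a set set \<Rightarrow> 'a set \<Rightarrow> bool" where
  "ul_indep I S \<longleftrightarrow> \<not> (\<exists>f\<in>I. f \<noteq> {} \<and> f \<subseteq> S)"

definition zero_dim_degree :: "'a set set \<Rightarrow> nat \<Rightarrow> bool" where
  "zero_dim_degree I r \<longleftrightarrow>
     (\<exists>S. ul_indep I S \<and> finite S \<and> card S = r) \<and>
     (\<forall>S. ul_indep I S \<longrightarrow> finite S \<and> card S \<le> r)"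

definition binomial_lattice :: "('a::ab_group_add) set set \<Rightarrow> 'a set" where
  "binomial_lattice I = {u - v | u v. {u, v} \<in> I} \<union> {0}"

definition sublattice :: "('a::ab_group_add) set \<Rightarrow> bool" where
  "sublattice L \<longleftrightarrow> 0 \<in> L \<and> (\<forall>a\<in>L. \<forall>b\<in>L. a + b \<in> L) \<and> (\<forall>a\<in>L. - a \<in> L)"

definition cosets :: "('a::ab_group_add) set \<Rightarrow> 'a set set" where
  "cosets L = {(\<lambda>l. a + l) ` L | a. True}"

definition circuit :: "('a set \<Rightarrow> bool) \<Rightarrow> 'a set \<Rightarrow> bool" where
  "circuit indep C \<longleftrightarrow> \<not> indep C \<and> (\<forall>x\<in>C. indep (C - {x}))"

definition parallel :: "('a set \<Rightarrow> bool) \<Rightarrow> 'a \<Rightarrow> 'a \<Rightarrow> bool" where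
  "parallel indep a b \<longleftrightarrow> a = b \<or> circuit indep {a, b}"

definition parallel_classes :: "('a set \<Rightarrow> bool) \<Rightarrow> 'a set \<Rightarrow> 'a set set" where
  "parallel_classes indep E = {{b \<in> E. parallel indep a b} | a. a \<in> E}"

definition si_indep :: "('a set \<Rightarrow> bool) \<Rightarrow> 'a set \<Rightarrow> 'a set set \<Rightarrow> bool" where
  "si_indep indep E S \<longleftrightarrow> S \<subseteq> parallel_classes indep E \<and>
     (\<exists>r. (\<forall>c\<in>S. r c \<in> c) \<and> inj_on r S \<and> indep (r ` S))"

text \<open>Rank of a subset (for matroids of finite rank).\<close>
definition mrank :: "('a set \<Rightarrow> bool) \<Rightarrow> 'a set \<Rightarrow> nat" where
  "mrank indep X = Max {card S | S. S \<subseteq> X \<and> finite S \<and> indep S}"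

definition hyperplanes :: "('a set \<Rightarrow> bool) \<Rightarrow> 'a set \<Rightarrow> 'a set set" where
  "hyperplanes indep E = {H. H \<subseteq> E \<and> mrank indep H = mrank indep E - 1 \<and>
      (\<forall>X. H \<subset> X \<and> X \<subseteq> E \<longrightarrow> mrank indep X \<noteq> mrank indep E - 1)}"

definition si_hyperplanes :: "'a set set \<Rightarrow> 'a set set set" where
  "si_hyperplanes I = hyperplanes (si_indep (ul_indep I) UNIV)
                         (parallel_classes (ul_indep I) UNIV)"

definition two_partition :: "'a set \<Rightarrow> 'a set set \<Rightarrow> bool" where
  "two_partition E P \<longleftrightarrow> (\<forall>B\<in>P. B \<subseteq> E) \<and> (\<exists>B1\<in>P. \<exists>B2\<in>P. B1 \<noteq> B2)
     \<and> (\<forall>B\<in>P. \<exists>x\<in>B. \<exists>y\<in>B. x \<noteq> y)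
     \<and> (\<forall>x\<in>E. \<forall>y\<in>E. x \<noteq> y \<longrightarrow> (\<exists>!B. B \<in> P \<and> x \<in> B \<and> y \<in> B))"

definition translate_coset :: "'a::plus \<Rightarrow> 'a set \<Rightarrow> 'a set" where
  "translate_coset u c = (\<lambda>x. u + x) ` c"

definition invariant_collection :: "('a::plus) set set set \<Rightarrow> bool" where
  "invariant_collection P \<longleftrightarrow> (\<forall>u. (\<lambda>B. translate_coset u ` B) ` P = P)"

end

theory Submission
  imports Defs
begin

text \<open>
  A tropical ideal is recovered from the hyperplanes of its underlying matroid: it consists of
  the finite sets \<open>f\<close> such that \<open>f - H\<close> is never a singleton for a hyperplane \<open>H\<close>, since the
  supports are exactly the unions of circuits.  In rank three the hyperplanes are the closures of
  two non-parallel points; they are unions of cosets of \<open>L\<^sub>I\<close>, and modulo \<open>L\<^sub>I\<close> they form a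
  2-partition because two points of the simplification span exactly one line.  Conversely the
  blocks of an invariant 2-partition of the quotient lift to a translation invariant family with
  the hyperplane exchange property, and the sets orthogonal to such a family form a tropical ideal.
\<close>

section \<open>Hyperplane families and the ideals orthogonal to them\<close>

text \<open>Complements of hyperplanes are cocircuits, so this is the orthogonality of circuits and
  cocircuits: a finite set that never meets a cocircuit in exactly one point.\<close>

definition orthogonal :: "'a set set \<Rightarrow> 'a set set" where
  "orthogonal \<H> = {f. finite f \<and> (\<forall>H\<in>\<H>. \<forall>w. f - H \<noteq> {w})}"

text \<open>Independence in terms of hyperplanes: each point can be cut off by a hyperplane through
  all the others.\<close>

definition separated :: "'a set set \<Rightarrow> 'a set \<Rightarrow> bool" where
  "separated \<H> S \<longleftrightarrow> (\<forall>v\<in>S. \<exists>H\<in>\<H>. S - H = {v})"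

text \<open>Strong circuit elimination for the complements: \<open>x\<close> is eliminated from the
  complements of \<open>H1\<close> and \<open>H2\<close>, while \<open>w\<close>, which lies only in
  the first, is kept.\<close>

definition hyperplane_exchange :: "'a set set \<Rightarrow> bool" where
  "hyperplane_exchange \<H> \<longleftrightarrow> (\<forall>H1\<in>\<H>. \<forall>H2\<in>\<H>. \<forall>x w.
     x \<notin> H1 \<longrightarrow> x \<notin> H2 \<longrightarrow> w \<notin> H1 \<longrightarrow> w \<in> H2 \<longrightarrow>
     (\<exists>H3\<in>\<H>. H1 \<inter> H2 \<subseteq> H3 \<and> x \<in> H3 \<and> w \<notin> H3))"

lemma orthogonal_Un:
  assumes f: "f \<in> orthogonal \<H>" and g: "g \<in> orthogonal \<H>"
  shows "f \<union> g \<in> orthogonal \<H>"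
proof -
  have "(f \<union> g) - H \<noteq> {w}" if H: "H \<in> \<H>" for H w
  proof
    assume "(f \<union> g) - H = {w}"
    then have "f - H = {w} \<or> g - H = {w}" by blast
    then show False using f g H by (auto simp: orthogonal_def)
  qed
  then show ?thesis using f g by (auto simp: orthogonal_def)
qed

lemma is_ideal_orthogonal:
  fixes \<H> :: "'a::ab_group_add set set"
  assumes inv: "\<And>H t. H \<in> \<H> \<Longrightarrow> (\<lambda>x. t + x) ` H \<in> \<H>"
  shows "is_ideal (orthogonal \<H>)"
proof -
  have "tmult g f \<in> orthogonal \<H>" if f: "f \<in> orthogonal \<H>" and g: "finite g" for f g
  proof -
    have "tmult g f = (\<lambda>(a, b). a + b) ` (g \<times> f)" by (auto simp: tmult_def)
    then have fin: "finite (tmult g f)" using f g by (auto simp: orthogonal_def)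
    have "tmult g f - H \<noteq> {w}" if H: "H \<in> \<H>" for H w
    proof
      assume eq: "tmult g f - H = {w}"
      then have "w \<in> tmult g f" by blast
      then obtain a b where ab: "a \<in> g" "b \<in> f" "w = a + b" unfolding tmult_def by blast
      \<comment> \<open>The translate of \<open>f\<close> by \<open>a\<close> is part of the
        product, so moving \<open>H\<close> back by \<open>a\<close> isolates \<open>b\<close> in
        \<open>f\<close>.\<close>
      have "f - (\<lambda>x. - a + x) ` H = {b}"
      proof (intro equalityI subsetI)
        fix y assume y: "y \<in> f - (\<lambda>x. - a + x) ` H"
        have "y = - a + (a + y)" by simp
        then have "a + y \<notin> H" using y by blast
        then have "a + y \<in> tmult g f - H" using y ab by (auto simp: tmult_def)
        then show "y \<in> {b}" using eq ab by auto
      next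
        fix y assume "y \<in> {b}"
        moreover have "w \<notin> H" using eq by auto
        ultimately show "y \<in> f - (\<lambda>x. - a + x) ` H" using ab by auto
      qed
      then show False using f inv[OF H, of "- a"] by (auto simp: orthogonal_def)
    qed
    then show ?thesis using fin by (simp add: orthogonal_def)
  qed
  moreover have "{} \<in> orthogonal \<H>" "\<forall>f\<in>orthogonal \<H>. finite f"
    by (simp_all add: orthogonal_def)
  ultimately show ?thesis
    unfolding is_ideal_def using orthogonal_Un by (intro conjI ballI allI impI) blast+
qed

text \<open>The set below is \<open>T\<close> without its coloops.\<close>

lemma coloop_free_part_orthogonal:
  assumes ex: "hyperplane_exchange \<H>" and T: "finite T"
  shows "{v\<in>T. \<forall>H\<in>\<H>. T - H \<noteq> {v}} \<in> orthogonal \<H>" (is "?h \<in> _")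
proof -
  \<comment> \<open>Descent on the number of points of \<open>T\<close> off \<open>H\<close>. As
    \<open>w\<close> is no coloop, \<open>H\<close> also misses some other \<open>c\<close> in
    \<open>T\<close>; this \<open>c\<close> lies outside \<open>?h\<close>, hence is a coloop, cut
    off by some \<open>Hc\<close>. Exchanging at \<open>c\<close> gives a hyperplane
    \<open>K\<close> that still misses \<open>w\<close> but misses fewer points of
    \<open>T\<close>.\<close>
  have no: "\<not> (w \<in> ?h \<and> H \<in> \<H> \<and> w \<notin> H \<and> ?h - H \<subseteq> {w})" for w H
  proof (induction "card (T - H)" arbitrary: H rule: less_induct)
    case less
    show ?case
    proof
      assume A: "w \<in> ?h \<and> H \<in> \<H> \<and> w \<notin> H \<and> ?h - H \<subseteq> {w}"
      then have "T - H \<noteq> {w}" "w \<in> T - H" by auto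
      then obtain c where c: "c \<in> T" "c \<notin> H" "c \<noteq> w" by blast
      then have "c \<notin> ?h" using A by blast
      then obtain Hc where Hc: "Hc \<in> \<H>" "T - Hc = {c}" using c by blast
      have "w \<in> Hc" "c \<notin> Hc" using Hc c A by auto
      then obtain K where K: "K \<in> \<H>" "H \<inter> Hc \<subseteq> K" "c \<in> K" "w \<notin> K"
        using ex[unfolded hyperplane_exchange_def, rule_format, of H Hc c w] A Hc c by blast
      have "\<forall>x\<in>T. x \<notin> Hc \<longrightarrow> x = c" using Hc by blast
      then have "T - K \<subseteq> T - H - {c}" using K by blast
      then have sub: "T - K \<subset> T - H" using c by blast
      then have "card (T - K) < card (T - H)" using T by (simp add: psubset_card_mono)
      moreover have "?h - K \<subseteq> ?h - H" using sub by blast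
      ultimately show False using less[of K] K A by blast
    qed
  qed
  have "?h - H \<noteq> {w}" if H: "H \<in> \<H>" for H w
  proof
    assume eq: "?h - H = {w}"
    then have "w \<in> ?h - H" by (metis singletonI)
    then show False using no[of w H] H eq by (metis (no_types, lifting) DiffE order_refl)
  qed
  then show ?thesis using T by (simp add: orthogonal_def)
qed

text \<open>The eliminating vector is \<open>f \<union> g - {u}\<close> without its coloops, so it
  remains to see that no point of the symmetric difference is such a coloop.\<close>

lemma tropical_ideal_orthogonal:
  fixes \<H> :: "'a::ab_group_add set set"
  assumes inv: "\<And>H t. H \<in> \<H> \<Longrightarrow> (\<lambda>x. t + x) ` H \<in> \<H>"
    and ex: "hyperplane_exchange \<H>"
  shows "tropical_ideal (orthogonal \<H>)"
  unfolding tropical_ideal_def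
proof (intro conjI ballI)
  show "is_ideal (orthogonal \<H>)" by (rule is_ideal_orthogonal) (rule inv)
next
  fix f g u assume f: "f \<in> orthogonal \<H>" and g: "g \<in> orthogonal \<H>" and u: "u \<in> f \<inter> g"
  let ?T = "f \<union> g - {u}"
  let ?h = "{v\<in>?T. \<forall>H\<in>\<H>. ?T - H \<noteq> {v}}"
  \<comment> \<open>If \<open>H\<close> isolates \<open>v\<close> from \<open>f - g\<close>, then
    \<open>g\<close> can leave \<open>H\<close> only at \<open>u\<close>; orthogonality of
    \<open>g\<close> forces \<open>u\<close> into \<open>H\<close>, and then \<open>H\<close>
    isolates \<open>v\<close> already in \<open>f\<close>. The claim is generic in \<open>f\<close>
    and \<open>g\<close> so that it can be used with the roles swapped.\<close>
  have half: "f - g \<subseteq> {v\<in>f \<union> g - {u}. \<forall>H\<in>\<H>. (f \<union> g - {u}) - H \<noteq> {v}}"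
    if f: "f \<in> orthogonal \<H>" and g: "g \<in> orthogonal \<H>" and u: "u \<in> f \<inter> g" for f g
  proof
    fix v assume v: "v \<in> f - g"
    have "(f \<union> g - {u}) - H \<noteq> {v}" if H: "H \<in> \<H>" for H
    proof
      assume eq: "(f \<union> g - {u}) - H = {v}"
      then have iff: "(x \<in> f \<or> x \<in> g) \<and> x \<noteq> u \<and> x \<notin> H \<longleftrightarrow> x = v" for x
        by (simp add: set_eq_iff)
      have gu: "g - H \<subseteq> {u}"
      proof
        fix x assume x: "x \<in> g - H"
        then have "x \<noteq> v" using v by auto
        then show "x \<in> {u}" using iff[of x] x by auto
      qed
      have "g - H \<noteq> {u}" using g H by (auto simp: orthogonal_def)
      then have "u \<in> H" using u gu by auto
      then have "x \<in> f - H \<longleftrightarrow> x = v" for x using iff[of x] v by auto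
      then have "f - H = {v}" by auto
      then show False using f H by (auto simp: orthogonal_def)
    qed
    then show "v \<in> {v\<in>f \<union> g - {u}. \<forall>H\<in>\<H>. (f \<union> g - {u}) - H \<noteq> {v}}" using v u by auto
  qed
  have "?h \<in> orthogonal \<H>"
    using coloop_free_part_orthogonal[OF ex, of ?T] f g by (auto simp: orthogonal_def)
  moreover have "f - g \<union> (g - f) \<subseteq> ?h"
    using half[OF f g u] half[OF g f] u by (auto simp: Un_commute)
  ultimately show "\<exists>h\<in>orthogonal \<H>. f - g \<union> (g - f) \<subseteq> h \<and> h \<subseteq> f \<union> g - {u}" by blast
qed

text \<open>The non-coloops of \<open>S\<close> form a vector inside \<open>S\<close>, which
  independence makes empty. Conversely, a hyperplane isolating \<open>v\<close> in \<open>S\<close>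
  also isolates it in every subset containing \<open>v\<close>.\<close>

lemma ul_indep_orthogonal_iff:
  assumes ex: "hyperplane_exchange \<H>" and S: "finite S"
  shows "ul_indep (orthogonal \<H>) S \<longleftrightarrow> separated \<H> S"
proof
  assume ind: "ul_indep (orthogonal \<H>) S"
  have "{v\<in>S. \<forall>H\<in>\<H>. S - H \<noteq> {v}} = {}"
  proof (rule ccontr)
    assume "{v\<in>S. \<forall>H\<in>\<H>. S - H \<noteq> {v}} \<noteq> {}"
    with coloop_free_part_orthogonal[OF ex S] have "\<not> ul_indep (orthogonal \<H>) S"
      unfolding ul_indep_def by (metis (no_types, lifting) mem_Collect_eq subsetI)
    then show False using ind by contradiction
  qed
  then show "separated \<H> S" unfolding separated_def by auto
next
  assume sep: "separated \<H> S"
  have False if f: "f \<in> orthogonal \<H>" "f \<noteq> {}" "f \<subseteq> S" for f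
  proof -
    obtain v where v: "v \<in> f" using f(2) by auto
    then have "v \<in> S" using f(3) by auto
    then obtain H where H: "H \<in> \<H>" "S - H = {v}"
      using bspec[OF sep[unfolded separated_def]] by metis
    then have "f - H \<subseteq> {v}" "v \<notin> H" using Diff_mono[OF f(3) order_refl, of H] by auto
    then have "f - H = {v}" using v by auto
    then show False using f(1) H(1) by (simp add: orthogonal_def)
  qed
  then show "ul_indep (orthogonal \<H>) S" unfolding ul_indep_def by metis
qed

section \<open>Two-partitions as rank three matroids\<close>

text \<open>Points and blocks form a linear space of incidence geometry; having two blocks means
  that the points are not all collinear.\<close>

locale linear_space =
  fixes E :: "'p set" and P :: "'p set set"
  assumes two_partition: "two_partition E P"
begin

lemma block_subset: "B \<in> P \<Longrightarrow> B \<subseteq> E"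
  and block_two_points: "B \<in> P \<Longrightarrow> \<exists>x\<in>B. \<exists>y\<in>B. x \<noteq> y"
  and two_blocks: "\<exists>B1\<in>P. \<exists>B2\<in>P. B1 \<noteq> B2"
  and block_ex1: "x \<in> E \<Longrightarrow> y \<in> E \<Longrightarrow> x \<noteq> y \<Longrightarrow> \<exists>!B. B \<in> P \<and> x \<in> B \<and> y \<in> B"
  using two_partition unfolding two_partition_def by simp_all

lemma block_exists: "x \<in> E \<Longrightarrow> y \<in> E \<Longrightarrow> x \<noteq> y \<Longrightarrow> \<exists>B\<in>P. x \<in> B \<and> y \<in> B"
  using block_ex1 by (meson ex1_implies_ex)

lemma block_unique:
  assumes "B \<in> P" "B' \<in> P" "x \<in> B" "y \<in> B" "x \<in> B'" "y \<in> B'" "x \<noteq> y"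
  shows "B = B'"
proof -
  have "x \<in> E" "y \<in> E" using assms block_subset by auto
  from ex1E[OF block_ex1[OF this \<open>x \<noteq> y\<close>]] show ?thesis using assms by metis
qed

text \<open>Another block has two points, and they cannot both lie on \<open>B\<close>.\<close>

lemma point_off_block:
  assumes B: "B \<in> P"
  shows "\<exists>x\<in>E. x \<notin> B"
proof -
  obtain B' where B': "B' \<in> P" "B' \<noteq> B" using two_blocks by metis
  obtain x y where "x \<in> B'" "y \<in> B'" "x \<noteq> y" using block_two_points B' by blast
  then show ?thesis using block_unique[of B' B x y] B B' block_subset by blast
qed

text \<open>Join \<open>p\<close> to a point off the block through \<open>p\<close> and
  \<open>q\<close>.\<close>

lemma separating_block:
  assumes "p \<in> E" "q \<in> E" "p \<noteq> q"
  shows "\<exists>B\<in>P. p \<in> B \<and> q \<notin> B"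
proof -
  obtain B where B: "B \<in> P" "p \<in> B" "q \<in> B" using block_exists assms by blast
  obtain r where r: "r \<in> E" "r \<notin> B" using point_off_block B by blast
  then obtain B' where B': "B' \<in> P" "p \<in> B'" "r \<in> B'" using block_exists[of p r] assms B by blast
  then have "q \<notin> B'" using block_unique[of B B' p q] B assms r by blast
  then show ?thesis using B' by blast
qed

lemma block_avoiding:
  assumes "p \<in> E"
  shows "\<exists>B\<in>P. p \<notin> B"
proof -
  obtain B where "B \<in> P" using two_blocks by blast
  then obtain x where "x \<in> E" "x \<noteq> p" using block_two_points block_subset by (metis subsetD)
  then show ?thesis using separating_block[of x p] assms by blast
qed

text \<open>For disjoint blocks, join \<open>x\<close> to two points of \<open>B1\<close>: the two
  joins share only \<open>x\<close>, so one of them avoids \<open>w\<close>. For blocks meeting in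
  \<open>p\<close>, the join of \<open>x\<close> and \<open>p\<close> meets \<open>B2\<close> only
  in \<open>p\<close>.\<close>

lemma block_exchange:
  assumes B: "B1 \<in> P" "B2 \<in> P" and x: "x \<in> E" "x \<notin> B1" "x \<notin> B2"
    and w: "w \<notin> B1" "w \<in> B2"
  shows "\<exists>B3\<in>P. B1 \<inter> B2 \<subseteq> B3 \<and> x \<in> B3 \<and> w \<notin> B3"
proof (cases "B1 \<inter> B2 = {}")
  case True
  obtain a b where ab: "a \<in> B1" "b \<in> B1" "a \<noteq> b" using block_two_points B by blast
  then have abE: "a \<in> E" "b \<in> E" "a \<noteq> x" "b \<noteq> x" using B block_subset x by blast+
  obtain A where A: "A \<in> P" "x \<in> A" "a \<in> A" using block_exists[of x a] abE x by blast
  obtain D where D: "D \<in> P" "x \<in> D" "b \<in> D" using block_exists[of x b] abE x by blast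
  have "w \<notin> A \<or> w \<notin> D"
  proof (rule ccontr)
    assume "\<not> ?thesis"
    then have "A = D" using block_unique[of A D x w] A D x w by blast
    then have "A = B1" using block_unique[of A B1 a b] A D B ab by blast
    then show False using A x by blast
  qed
  then show ?thesis using A D True by blast
next
  case False
  then obtain p where p: "p \<in> B1" "p \<in> B2" by blast
  have "B1 \<noteq> B2" using w by blast
  then have one: "B1 \<inter> B2 \<subseteq> {p}" using block_unique[of B1 B2 p] B p by blast
  obtain A where A: "A \<in> P" "x \<in> A" "p \<in> A"
    using block_exists[of x p] p x B block_subset by blast
  have "w \<notin> A" using block_unique[of A B2 p w] A B p w x by blast
  then show ?thesis using A one by blast
qed

section \<open>Independence and rank defined by the blocks\<close>

lemma separated_small:
  assumes "separated P S"
  shows "finite S \<and> card S \<le> 3"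
proof -
  have "\<exists>a b c. S \<subseteq> {a, b, c}"
  proof (cases "\<exists>v\<in>S. \<exists>w\<in>S. v \<noteq> w")
    case False
    then show ?thesis by blast
  next
    case True
    then obtain v w where vw: "v \<in> S" "w \<in> S" "v \<noteq> w" by blast
    then obtain B B' where B: "B \<in> P" "S - B = {v}" "B' \<in> P" "S - B' = {w}"
      using assms unfolding separated_def by meson
    \<comment> \<open>Everything in \<open>S\<close> except \<open>v\<close> and \<open>w\<close>
      lies on both blocks, and distinct blocks share at most one point.\<close>
    then have "B \<noteq> B'" using vw by auto
    then have "\<exists>c. B \<inter> B' \<subseteq> {c}" using block_unique[of B B'] B by blast
    moreover have "S - {v, w} \<subseteq> B \<inter> B'" using B by blast
    ultimately show ?thesis by blast
  qed
  then obtain a b c where "S \<subseteq> {a, b, c}" by blast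
  moreover have "card {a, b, c} \<le> 3" by (simp add: card_insert_if)
  ultimately show ?thesis by (meson card_mono finite.emptyI finite_insert le_trans finite_subset)
qed

lemma separated_pair:
  assumes "p \<in> E" "q \<in> E"
  shows "separated P {p, q}"
proof -
  have *: "\<exists>B\<in>P. {p, q} - B = {p}" if pq: "p \<in> E" "q \<in> E" for p q
  proof (cases "p = q")
    case True
    then show ?thesis using block_avoiding pq by auto
  next
    case False
    then obtain B where "B \<in> P" "q \<in> B" "p \<notin> B" using separating_block pq by metis
    then show ?thesis by (intro bexI[of _ B]) auto
  qed
  show ?thesis using *[of p q] *[of q p] assms unfolding separated_def by (auto simp: insert_commute)
qed

text \<open>The three joins of pairs each cut off the remaining point.\<close>

lemma separated_triple:
  assumes B: "B \<in> P" "p \<in> B" "q \<in> B" and pq: "p \<noteq> q" and x: "x \<in> E" "x \<notin> B"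
  shows "separated P {p, q, x}"
proof -
  have *: "\<exists>D\<in>P. {p, q, x} - D = {q}" if pq: "p \<in> B" "q \<in> B" "p \<noteq> q" for p q
  proof -
    obtain D where D: "D \<in> P" "p \<in> D" "x \<in> D"
      using block_exists[of p x] B block_subset pq x by blast
    then have "q \<notin> D" using block_unique[of B D p q] B pq x by blast
    then show ?thesis using D by (intro bexI[of _ D]) auto
  qed
  have "{p, q, x} - B = {x}" using B x by auto
  then show ?thesis
    using *[of p q] *[of q p] B pq unfolding separated_def by (auto simp: insert_commute)
qed

text \<open>Blocks have rank two, and a block with one further point contains an independent triple.
  The predicate \<open>ind\<close> is left general so that the independence predicate of the
  simplification can be inserted.\<close>

lemma hyperplanes_eq_blocks:
  assumes ind: "\<And>S. S \<subseteq> E \<Longrightarrow> ind S \<longleftrightarrow> separated P S"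
  shows "hyperplanes ind E = P"
proof -
  \<comment> \<open>\<open>mrank\<close> is a \<open>Max\<close>, which is meaningful only for a
    finite nonempty set; nonemptiness comes from the empty independent set in
    \<open>att\<close>.\<close>
  have fin: "finite {card S | S. S \<subseteq> X \<and> finite S \<and> ind S}" if "X \<subseteq> E" for X
    by (rule finite_subset[of _ "{..3}"]) (use ind separated_small that in auto)
  have ge: "card S \<le> mrank ind X" if "X \<subseteq> E" "S \<subseteq> X" "separated P S" for S X
    unfolding mrank_def using that ind separated_small
    by (intro Max_ge[OF fin]) blast+
  have att: "\<exists>S. S \<subseteq> X \<and> finite S \<and> separated P S \<and> card S = mrank ind X" if X: "X \<subseteq> E" for X
  proof -
    have "ind {}" using ind by (simp add: separated_def)
    then have "{card S | S. S \<subseteq> X \<and> finite S \<and> ind S} \<noteq> {}" by blast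
    from Max_in[OF fin[OF X] this] show ?thesis
      using ind X unfolding mrank_def by (smt (verit) mem_Collect_eq order_trans)
  qed
  have triple: "3 \<le> mrank ind X"
    if "B \<in> P" "p \<in> B" "q \<in> B" "p \<noteq> q" "x \<notin> B" "{p, q, x} \<subseteq> X" "X \<subseteq> E" for B p q x X
  proof -
    have "card {p, q, x} \<le> mrank ind X"
      using ge[OF _ _ separated_triple[of B p q x]] that by blast
    moreover have "p \<noteq> x" "q \<noteq> x" using that by auto
    then have "card {p, q, x} = 3" using that(4) by simp
    ultimately show ?thesis by simp
  qed
  have le3: "mrank ind X \<le> 3" if "X \<subseteq> E" for X
    using att[OF that] separated_small by metis
  have block_rank: "mrank ind B = 2" if B: "B \<in> P" for B
  proof (rule antisym)
    obtain S where S: "S \<subseteq> B" "finite S" "separated P S" "card S = mrank ind B"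
      using att block_subset B by metis
    show "mrank ind B \<le> 2"
    proof (rule ccontr)
      assume "\<not> ?thesis"
      \<comment> \<open>The block \<open>D\<close> that cuts off \<open>v\<close> shares at least
        two other points of \<open>S\<close> with \<open>B\<close>, so it equals \<open>B\<close>,
        although only \<open>B\<close> contains \<open>v\<close>.\<close>
      then have c: "card S \<ge> 3" using S by simp
      then obtain v where v: "v \<in> S" by fastforce
      then obtain D where D: "D \<in> P" "S - D = {v}"
        using bspec[OF S(3)[unfolded separated_def]] by metis
      have "\<not> card (S - {v}) \<le> Suc 0" using c v by simp
      then obtain a b where "a \<in> S - {v}" "b \<in> S - {v}" "a \<noteq> b"
        using card_le_Suc0_iff_eq[of "S - {v}"] S(2) by (metis finite_Diff)
      moreover have "x \<in> B \<and> x \<in> D" if "x \<in> S - {v}" for x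
        using that D(2) S(1) by (metis Diff_iff subsetD)
      ultimately have "B = D" using block_unique[OF B D(1)] by metis
      then show False using D S by blast
    qed
    obtain p q where "p \<in> B" "q \<in> B" "p \<noteq> q" using block_two_points B by blast
    moreover then have "card {p, q} \<le> mrank ind B"
      using ge[of B "{p, q}"] separated_pair[of p q] B block_subset by blast
    ultimately show "2 \<le> mrank ind B" by simp
  qed
  have rank_E: "mrank ind E = 3"
  proof (rule antisym)
    obtain B where B: "B \<in> P" using two_blocks by blast
    obtain p q where "p \<in> B" "q \<in> B" "p \<noteq> q" using block_two_points B by blast
    moreover obtain x where "x \<in> E" "x \<notin> B" using point_off_block B by blast
    ultimately show "3 \<le> mrank ind E" using triple[of B p q x E] B block_subset by blast
  qed (simp add: le3)
  show ?thesis
  proof (intro equalityI subsetI)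
    fix B assume B: "B \<in> P"
    have "mrank ind X \<noteq> 2" if X: "B \<subset> X" "X \<subseteq> E" for X
    proof -
      obtain p q where "p \<in> B" "q \<in> B" "p \<noteq> q" using block_two_points B by blast
      moreover obtain x where "x \<in> X" "x \<notin> B" using X by blast
      moreover have "y \<in> X" if "y \<in> B" for y using that X(1) by auto
      ultimately have "3 \<le> mrank ind X" using triple[of B p q x X] B X(2) by simp
      then show ?thesis by simp
    qed
    then show "B \<in> hyperplanes ind E"
      using block_rank[OF B] block_subset[OF B] by (simp add: hyperplanes_def rank_E)
  next
    fix H assume "H \<in> hyperplanes ind E"
    then have H: "H \<subseteq> E" "mrank ind H = 2" "\<And>X. H \<subset> X \<Longrightarrow> X \<subseteq> E \<Longrightarrow> mrank ind X \<noteq> 2"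
      by (auto simp: hyperplanes_def rank_E)
    then obtain S where S: "S \<subseteq> H" "card S = 2" using att by metis
    then obtain p q where pq: "p \<in> H" "q \<in> H" "p \<noteq> q" by (auto simp: card_2_iff)
    then obtain B where B: "B \<in> P" "p \<in> B" "q \<in> B" using block_exists H by blast
    \<comment> \<open>A point of \<open>H\<close> off the join \<open>B\<close> of \<open>p\<close>
      and \<open>q\<close> would raise the rank of \<open>H\<close> to three.\<close>
    have "H \<subseteq> B" using triple[of B p q _ H] B pq H by fastforce
    moreover have "\<not> H \<subset> B" using H(3) block_rank block_subset B by blast
    ultimately show "H \<in> P" using B by blast
  qed
qed

end

section \<open>Closure in the underlying matroid\<close>

text \<open>Matroid closure, with arbitrary vectors through \<open>x\<close> in place of circuits;
  \<open>S\<close> may be infinite.\<close>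

definition ul_closure :: "'a set set \<Rightarrow> 'a set \<Rightarrow> 'a set" where
  "ul_closure I S = S \<union> {x. \<exists>f\<in>I. x \<in> f \<and> f \<subseteq> insert x S}"

lemma ul_closureE:
  assumes "x \<in> ul_closure I S" "x \<notin> S"
  obtains f where "f \<in> I" "x \<in> f" "f \<subseteq> insert x S"
  using assms unfolding ul_closure_def by blast

lemma ul_closureI: "f \<in> I \<Longrightarrow> x \<in> f \<Longrightarrow> f \<subseteq> insert x S \<Longrightarrow> x \<in> ul_closure I S"
  unfolding ul_closure_def by blast

lemma subset_ul_closure: "S \<subseteq> ul_closure I S"
  unfolding ul_closure_def by blast

lemma in_ul_closure: "x \<in> S \<Longrightarrow> x \<in> ul_closure I S"
  by (simp add: ul_closure_def)

lemma ul_closure_mono: "S \<subseteq> T \<Longrightarrow> ul_closure I S \<subseteq> ul_closure I T"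
  unfolding ul_closure_def by blast

lemma ul_indep_subset: "ul_indep I T \<Longrightarrow> S \<subseteq> T \<Longrightarrow> ul_indep I S"
  unfolding ul_indep_def by blast

lemma ul_indep_not_in_closure:
  assumes "ul_indep I (insert x S)" "x \<notin> S"
  shows "x \<notin> ul_closure I S"
  using assms ul_closureE unfolding ul_indep_def by (metis empty_iff)

lemma ul_indep_insert:
  assumes "ul_indep I S" "x \<notin> ul_closure I S"
  shows "ul_indep I (insert x S)"
proof -
  have "f = {}" if f: "f \<in> I" "f \<subseteq> insert x S" for f
  proof -
    have "x \<notin> f" using f assms(2) ul_closureI by metis
    then have "f \<subseteq> S" using f(2) by auto
    then show ?thesis using f(1) assms(1) unfolding ul_indep_def by metis
  qed
  then show ?thesis unfolding ul_indep_def by metis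
qed

text \<open>A vector putting \<open>x\<close> into the larger closure must contain \<open>y\<close>,
  so the same vector serves for \<open>y\<close>.\<close>

lemma ul_closure_exchange:
  assumes x: "x \<in> ul_closure I (insert y S)" "x \<notin> ul_closure I S"
  shows "y \<in> ul_closure I (insert x S)"
proof (cases "x = y")
  case False
  have "x \<notin> S" using x(2) in_ul_closure by metis
  then obtain f where f: "f \<in> I" "x \<in> f" "f \<subseteq> insert x (insert y S)"
    using ul_closureE x(1) False by (metis insertE)
  then have "y \<in> f" using x(2) ul_closureI[of f I x S] by blast
  then show ?thesis using f by (intro ul_closureI[of f]) auto
qed (simp add: ul_closure_def)

section \<open>Closure and exchange in a tropical ideal\<close>

locale tropical =
  fixes I :: "'a::ab_group_add set set"
  assumes tropical_ideal: "tropical_ideal I"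
begin

abbreviation cl where "cl \<equiv> ul_closure I"

lemma finite_vector: "f \<in> I \<Longrightarrow> finite f"
  and vector_Un: "f \<in> I \<Longrightarrow> g \<in> I \<Longrightarrow> f \<union> g \<in> I"
  and vector_tmult: "f \<in> I \<Longrightarrow> finite g \<Longrightarrow> tmult g f \<in> I"
  using tropical_ideal unfolding tropical_ideal_def is_ideal_def by simp_all

lemma vector_elimination:
  assumes "f \<in> I" "g \<in> I" "u \<in> f" "u \<in> g"
  obtains h where "h \<in> I" "(f - g) \<union> (g - f) \<subseteq> h" "h \<subseteq> f \<union> g - {u}"
  using tropical_ideal assms unfolding tropical_ideal_def by (meson IntI)

lemma vector_empty: "{} \<in> I"
proof -
  obtain f where "f \<in> I"
    using tropical_ideal unfolding tropical_ideal_def is_ideal_def by (metis ex_in_conv)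
  then have "tmult {} f \<in> I" by (rule vector_tmult) simp
  then show ?thesis by (simp add: tmult_def)
qed

lemma vector_translate:
  assumes "f \<in> I"
  shows "(\<lambda>x. t + x) ` f \<in> I"
proof -
  have "tmult {t} f = (\<lambda>x. t + x) ` f" by (auto simp: tmult_def)
  then show ?thesis using vector_tmult[OF assms, of "{t}"] by simp
qed

lemma vector_Union:
  assumes "finite F" "F \<subseteq> I"
  shows "\<Union>F \<in> I"
  using assms by (induction F) (simp_all add: vector_empty vector_Un)

lemma closure_idem: "cl (cl S) = cl S"
proof (rule antisym)
  \<comment> \<open>Induction on the number of points of \<open>f\<close> outside
    \<open>insert x S\<close>. Such a point \<open>u\<close> lies in \<open>cl S\<close> and is
    eliminated with a vector \<open>g\<close> inside \<open>insert u S\<close>; since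
    \<open>x\<close> is not in \<open>g\<close>, it survives, and no new outside points
    arise.\<close>
  have "x \<in> cl S" if "f \<in> I" "x \<in> f" "f \<subseteq> insert x (cl S)" for f x
    using that
  proof (induction "card (f - insert x S)" arbitrary: f rule: less_induct)
    case less
    show ?case
    proof (cases "x \<in> S \<or> f \<subseteq> insert x S")
      case True
      then show ?thesis using less.prems ul_closureI[of f] in_ul_closure by metis
    next
      case False
      then obtain u where u: "u \<in> f" "u \<noteq> x" "u \<notin> S" by blast
      then obtain g where g: "g \<in> I" "u \<in> g" "g \<subseteq> insert u S"
        using less.prems ul_closureE by (metis insertE subsetD)
      obtain h where h: "h \<in> I" "(f - g) \<union> (g - f) \<subseteq> h" "h \<subseteq> f \<union> g - {u}"
        using vector_elimination less.prems(1) g(1,2) u(1) by metis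
      have "x \<in> h" using h g u False less.prems by blast
      moreover have "h \<subseteq> insert x (cl S)"
        using h g less.prems subset_ul_closure[of S I] by blast
      moreover have "card (h - insert x S) < card (f - insert x S)"
      proof (rule psubset_card_mono)
        show "h - insert x S \<subset> f - insert x S" using h g u by blast
      qed (use finite_vector less.prems in blast)
      ultimately show ?thesis using less.hyps h(1) by blast
    qed
  qed
  then show "cl (cl S) \<subseteq> cl S" using ul_closureE by (metis subsetI)
qed (rule subset_ul_closure)

lemma closure_least: "S \<subseteq> cl T \<Longrightarrow> cl S \<subseteq> cl T"
  using ul_closure_mono[of S "cl T" I] closure_idem by simp

lemma steinitz:
  assumes "finite A" "finite S" "ul_indep I S" "S \<subseteq> cl A"
  shows "card S \<le> card A"
  using assms(2-)
proof (induction "card (S - A)" arbitrary: S rule: less_induct)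
  case less
  show ?case
  proof (cases "S \<subseteq> A")
    case True
    then show ?thesis using assms(1) card_mono by blast
  next
    case False
    then obtain s where s: "s \<in> S" "s \<notin> A" by blast
    have "s \<notin> cl (S - {s})"
      using ul_indep_not_in_closure[of I s "S - {s}"] less.prems s by (simp add: insert_absorb)
    \<comment> \<open>Otherwise \<open>cl A\<close>, and with it \<open>s\<close>, would lie in
      \<open>cl (S - {s})\<close>. So some \<open>a\<close> in \<open>A\<close> can replace
      \<open>s\<close>, which brings \<open>S\<close> closer to \<open>A\<close> without changing
      its size.\<close>
    then have "\<not> A \<subseteq> cl (S - {s})" using closure_least less.prems s by blast
    then obtain a where a: "a \<in> A" "a \<notin> cl (S - {s})" by blast
    then have "a \<notin> S - {s}" using in_ul_closure by metis
    let ?S = "insert a (S - {s})"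
    have ind: "ul_indep I ?S"
      using a less.prems by (intro ul_indep_insert) (auto intro: ul_indep_subset)
    have sub: "?S \<subseteq> cl A" using less.prems(3) a(1) by (auto simp: in_ul_closure)
    have "card (?S - A) < card (S - A)"
      by (rule psubset_card_mono) (use less.prems a s in auto)
    from less.hyps[OF this _ ind sub] have "card ?S \<le> card A" using less.prems(1) by simp
    moreover have "card ?S = card S"
      using card_insert_disjoint[OF _ \<open>a \<notin> S - {s}\<close>] card_Suc_Diff1[OF less.prems(1) s(1)] less.prems(1)
      by (metis finite_Diff)
    ultimately show ?thesis by simp
  qed
qed

section \<open>Parallel points and the binomial lattice\<close>

text \<open>This agrees with parallelism in the underlying matroid as soon as no singleton is a
  vector.\<close>

definition parallel_points :: "'a \<Rightarrow> 'a \<Rightarrow> bool" where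
  "parallel_points a b \<longleftrightarrow> a = b \<or> {a, b} \<in> I"

lemma parallel_points_sym: "parallel_points a b \<Longrightarrow> parallel_points b a"
  unfolding parallel_points_def by (auto simp: insert_commute)

lemma parallel_points_trans:
  assumes "parallel_points a b" "parallel_points b c"
  shows "parallel_points a c"
proof (cases "a = b \<or> b = c \<or> a = c")
  case False
  then obtain h where "h \<in> I" "({a, b} - {b, c}) \<union> ({b, c} - {a, b}) \<subseteq> h" "h \<subseteq> {a, b} \<union> {b, c} - {b}"
    using assms vector_elimination[of "{a, b}" "{b, c}" b] unfolding parallel_points_def by blast
  from this False have "h \<in> I" "a \<in> h" "c \<in> h" "h \<subseteq> {a, c}" by auto
  moreover from this have "h = {a, c}" by auto
  ultimately have "{a, c} \<in> I" by simp
  then show ?thesis by (simp add: parallel_points_def)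
qed (use assms in \<open>auto simp: parallel_points_def\<close>)

lemma parallel_points_translate: "parallel_points a b \<Longrightarrow> parallel_points (t + a) (t + b)"
  using vector_translate[of "{a, b}" t] unfolding parallel_points_def by auto

lemma binomial_lattice_iff: "a - b \<in> binomial_lattice I \<longleftrightarrow> parallel_points a b"
proof
  assume "parallel_points a b"
  then show "a - b \<in> binomial_lattice I"
    unfolding binomial_lattice_def parallel_points_def by auto
next
  assume "a - b \<in> binomial_lattice I"
  then consider "a = b" | u v where "a - b = u - v" "{u, v} \<in> I"
    unfolding binomial_lattice_def by auto
  then show "parallel_points a b"
  proof cases
    case 2
    \<comment> \<open>A binomial with the right difference is shifted by \<open>b - v\<close> onto
      \<open>{a, b}\<close>.\<close>
    then have "parallel_points ((b - v) + u) ((b - v) + v)"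
      by (intro parallel_points_translate) (simp add: parallel_points_def)
    moreover have "(b - v) + u = b + (u - v)" by simp
    ultimately show ?thesis using 2(1)[symmetric] by simp
  qed (simp add: parallel_points_def)
qed

text \<open>The lattice is the parallel class of 0, so translation invariance turns transitivity and
  symmetry into closure under sums and negatives.\<close>

lemma sublattice_binomial_lattice: "sublattice (binomial_lattice I)"
proof -
  have *: "a \<in> binomial_lattice I \<longleftrightarrow> parallel_points a 0" for a
    using binomial_lattice_iff[of a 0] by simp
  have "parallel_points (a + b) 0" if "parallel_points a 0" "parallel_points b 0" for a b
    using parallel_points_translate[OF that(2), of a] that(1) parallel_points_trans by simp
  moreover have "parallel_points (- a) 0" if "parallel_points a 0" for a
    using parallel_points_translate[OF that, of "- a"] parallel_points_sym by simp
  ultimately show ?thesis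
    unfolding sublattice_def Ball_def * by (simp add: parallel_points_def[of 0 0])
qed

end

section \<open>The ideal of an invariant two-partition of a quotient\<close>

definition coset_of :: "'a::ab_group_add set \<Rightarrow> 'a \<Rightarrow> 'a set" where
  "coset_of L u = (\<lambda>l. u + l) ` L"

lemma cosets_eq_range: "cosets L = range (coset_of L)"
  unfolding cosets_def coset_of_def by auto

lemma cosetsE:
  assumes "c \<in> cosets L"
  obtains u where "c = coset_of L u"
  using assms unfolding cosets_eq_range by (rule imageE)

lemma mem_coset_of_diff: "x \<in> coset_of L u \<longleftrightarrow> x - u \<in> L"
proof -
  have "x = u + (x - u)" by simp
  then show ?thesis unfolding coset_of_def by (metis (no_types, lifting) add_diff_cancel_left' imageE imageI)
qed

lemma coset_of_eq_iff:
  assumes L: "sublattice L"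
  shows "coset_of L u = coset_of L v \<longleftrightarrow> u - v \<in> L"
proof
  assume "coset_of L u = coset_of L v"
  then have "u \<in> coset_of L v \<longleftrightarrow> u \<in> coset_of L u" by simp
  then show "u - v \<in> L" using L by (simp add: mem_coset_of_diff sublattice_def)
next
  assume uv: "u - v \<in> L"
  have "x - u \<in> L \<longleftrightarrow> x - v \<in> L" for x
  proof
    assume "x - u \<in> L"
    then have "(x - u) + (u - v) \<in> L" using uv L unfolding sublattice_def by metis
    then show "x - v \<in> L" by simp
  next
    assume "x - v \<in> L"
    then have "(x - v) + - (u - v) \<in> L" using uv L unfolding sublattice_def by metis
    then show "x - u \<in> L" by simp
  qed
  then show "coset_of L u = coset_of L v" by (simp add: set_eq_iff mem_coset_of_diff)
qed

lemma mem_coset_of: "sublattice L \<Longrightarrow> x \<in> coset_of L u \<longleftrightarrow> coset_of L x = coset_of L u"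
  by (simp add: mem_coset_of_diff coset_of_eq_iff)

lemma mem_Union_cosets:
  assumes L: "sublattice L" and B: "B \<subseteq> cosets L"
  shows "x \<in> \<Union>B \<longleftrightarrow> coset_of L x \<in> B"
proof
  assume "x \<in> \<Union>B"
  then obtain c where c: "c \<in> B" "x \<in> c" by (rule UnionE)
  then obtain u where "c = coset_of L u" using B cosets_eq_range by (metis imageE subsetD)
  then show "coset_of L x \<in> B" using c mem_coset_of[OF L] by simp
next
  assume "coset_of L x \<in> B"
  moreover have "x \<in> coset_of L x" using mem_coset_of[OF L] by simp
  ultimately show "x \<in> \<Union>B" by (rule UnionI)
qed

lemma translate_coset_of: "translate_coset t (coset_of L u) = coset_of L (t + u)"
  unfolding translate_coset_def coset_of_def by (simp add: image_image add.assoc)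

lemma invariant_collectionD:
  "invariant_collection P \<Longrightarrow> B \<in> P \<Longrightarrow> translate_coset t ` B \<in> P"
  unfolding invariant_collection_def by (metis imageI)

lemma invariant_collectionI:
  fixes P :: "'a::ab_group_add set set set"
  assumes "\<And>B t. B \<in> P \<Longrightarrow> translate_coset t ` B \<in> P"
  shows "invariant_collection P"
  unfolding invariant_collection_def
proof (intro allI equalityI subsetI)
  fix t B assume B: "B \<in> P"
  \<comment> \<open>Translation by \<open>- t\<close> inverts translation by \<open>t\<close>, so
    stability in one direction yields equality.\<close>
  have "B = translate_coset t ` translate_coset (- t) ` B"
    by (simp add: image_image translate_coset_def)
  then show "B \<in> (\<lambda>B. translate_coset t ` B) ` P" using assms[OF B] by (rule image_eqI)
qed (use assms in auto)

locale quotient_linear_space = linear_space "cosets L" P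
  for L :: "'a::ab_group_add set" and P +
  assumes sublattice: "sublattice L" and invariant: "invariant_collection P"
begin

abbreviation pr where "pr \<equiv> coset_of L"

text \<open>\<open>Union\<close> turns a block of cosets into its preimage under \<open>pr\<close>;
  these preimages are the intended hyperplanes.\<close>

definition J :: "'a set set" where "J = orthogonal (Union ` P)"

lemma pr_in: "pr x \<in> cosets L"
  by (simp add: cosets_eq_range)

lemma mem_Union_block: "B \<in> P \<Longrightarrow> x \<in> \<Union>B \<longleftrightarrow> pr x \<in> B"
  using mem_Union_cosets[OF sublattice block_subset] .

lemma hyperplane_translate:
  assumes "H \<in> Union ` P"
  shows "(\<lambda>x. t + x) ` H \<in> Union ` P"
proof -
  obtain B where B: "B \<in> P" "H = \<Union>B" using assms by (rule imageE) simp
  have "(\<lambda>x. t + x) ` H = \<Union>(translate_coset t ` B)"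
    unfolding B translate_coset_def by (simp add: image_Union image_image)
  then show ?thesis using invariant_collectionD[OF invariant B(1), of t] by (metis imageI)
qed

lemma exchange: "hyperplane_exchange (Union ` P)"
proof -
  have "\<exists>H3\<in>Union ` P. \<Union>B1 \<inter> \<Union>B2 \<subseteq> H3 \<and> x \<in> H3 \<and> w \<notin> H3"
    if B: "B1 \<in> P" "B2 \<in> P" and xw: "x \<notin> \<Union>B1" "x \<notin> \<Union>B2" "w \<notin> \<Union>B1" "w \<in> \<Union>B2" for B1 B2 x w
  proof -
    obtain B3 where B3: "B3 \<in> P" "B1 \<inter> B2 \<subseteq> B3" "pr x \<in> B3" "pr w \<notin> B3"
      using block_exchange[OF B pr_in, of x "pr w"] xw B mem_Union_block by metis
    have "y \<in> \<Union>B3" if y: "y \<in> \<Union>B1" "y \<in> \<Union>B2" for y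
    proof -
      have "pr y \<in> B1 \<inter> B2"
        using y mem_Union_block[OF B(1)] mem_Union_block[OF B(2)] by (simp only: IntI)
      then have "pr y \<in> B3" by (rule subsetD[OF B3(2)])
      then show ?thesis using mem_Union_block[OF B3(1)] by (simp only:)
    qed
    then have "\<Union>B1 \<inter> \<Union>B2 \<subseteq> \<Union>B3" by (metis IntE subsetI)
    then show ?thesis using B3 mem_Union_block by (metis imageI)
  qed
  then show ?thesis unfolding hyperplane_exchange_def by (simp add: ball_simps)
qed

lemma tropical_ideal_J: "tropical_ideal J"
  unfolding J_def by (rule tropical_ideal_orthogonal[OF hyperplane_translate exchange])

lemma Diff_Union_block_iff:
  assumes B: "B \<in> P"
  shows "S - \<Union>B = {v} \<longleftrightarrow> (\<forall>x. x \<in> S \<and> pr x \<notin> B \<longleftrightarrow> x = v)"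
proof -
  have "x \<in> S - \<Union>B \<longleftrightarrow> x \<in> S \<and> pr x \<notin> B" for x
    using mem_Union_block[OF B, of x] by (metis Diff_iff)
  then show ?thesis unfolding set_eq_iff by simp
qed

text \<open>Points of one coset lie in the same hyperplanes, so neither can be cut off from the
  other. On a set injected by \<open>pr\<close>, cutting off a point means the same above and
  below.\<close>

lemma separated_Union_iff: "separated (Union ` P) S \<longleftrightarrow> inj_on pr S \<and> separated P (pr ` S)"
proof
  assume sep: "separated (Union ` P) S"
  have B: "\<exists>B\<in>P. \<forall>x. x \<in> S \<and> pr x \<notin> B \<longleftrightarrow> x = v" if v: "v \<in> S" for v
  proof -
    obtain B where "B \<in> P" "S - \<Union>B = {v}"
      using bspec[OF sep[unfolded separated_def] v] by (metis imageE)
    then show ?thesis using Diff_Union_block_iff by metis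
  qed
  have "inj_on pr S"
    by (rule inj_onI) (metis B)
  moreover have "separated P (pr ` S)"
    unfolding separated_def
  proof
    fix p assume "p \<in> pr ` S"
    then obtain v where v: "v \<in> S" "p = pr v" by (rule imageE) simp
    then obtain B where B: "B \<in> P" "\<forall>x. x \<in> S \<and> pr x \<notin> B \<longleftrightarrow> x = v" using B by metis
    have "pr ` S - B = {p}"
    proof (rule subset_antisym)
      show "pr ` S - B \<subseteq> {p}"
      proof
        fix q assume "q \<in> pr ` S - B"
        then obtain x where "x \<in> S" "q = pr x" "pr x \<notin> B" by (metis DiffE imageE)
        then have "x = v" "q = pr x" using spec[OF B(2), of x] by simp_all
        then show "q \<in> {p}" using v(2) by simp
      qed
      have "pr v \<notin> B" using spec[OF B(2), of v] by simp
      then show "{p} \<subseteq> pr ` S - B" using v by simp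
    qed
    then show "\<exists>B\<in>P. pr ` S - B = {p}" using B(1) by metis
  qed
  ultimately show "inj_on pr S \<and> separated P (pr ` S)" ..
next
  assume A: "inj_on pr S \<and> separated P (pr ` S)"
  show "separated (Union ` P) S"
    unfolding separated_def
  proof
    fix v assume v: "v \<in> S"
    obtain B where B: "B \<in> P" "pr ` S - B = {pr v}"
      using A v unfolding separated_def by (metis imageI)
    have "x \<in> S \<and> pr x \<notin> B \<longleftrightarrow> x = v" for x
    proof
      assume x: "x \<in> S \<and> pr x \<notin> B"
      then have "pr x \<in> pr ` S - B" by simp
      then have "pr x = pr v" using B(2) by simp
      then show "x = v" using A x v by (metis inj_onD)
    next
      assume "x = v"
      moreover have "pr v \<in> pr ` S - B" using B(2) by simp
      ultimately show "x \<in> S \<and> pr x \<notin> B" using v by simp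
    qed
    then show "\<exists>H\<in>Union ` P. S - H = {v}" using B(1) Diff_Union_block_iff by (metis imageI)
  qed
qed

lemma ul_indep_J_iff: "ul_indep J S \<longleftrightarrow> inj_on pr S \<and> separated P (pr ` S)"
proof (cases "finite S")
  case True
  then show ?thesis
    using ul_indep_orthogonal_iff[OF exchange] separated_Union_iff by (simp add: J_def)
next
  case False
  have "\<not> ul_indep J S"
  proof
    assume ind: "ul_indep J S"
    \<comment> \<open>Four points suffice: a separated set of cosets has at most three
      elements.\<close>
    obtain F where F: "F \<subseteq> S" "finite F" "card F = 4"
      using infinite_arbitrarily_large[OF False] by metis
    then have "ul_indep J F" using ind ul_indep_subset by metis
    then have "inj_on pr F \<and> separated P (pr ` F)"
      using F(2) ul_indep_orthogonal_iff[OF exchange] separated_Union_iff by (simp add: J_def)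
    then have "card F \<le> 3" using separated_small card_image by metis
    then show False using F(3) by simp
  qed
  moreover have "\<not> (inj_on pr S \<and> separated P (pr ` S))"
    using False separated_small finite_imageD by metis
  ultimately show ?thesis by simp
qed

lemma zero_dim_degree_J: "zero_dim_degree J 3"
  unfolding zero_dim_degree_def
proof (intro conjI allI impI)
  fix S assume "ul_indep J S"
  then have S: "inj_on pr S" "separated P (pr ` S)" by (simp_all add: ul_indep_J_iff)
  then show "finite S" using separated_small finite_imageD by metis
  show "card S \<le> 3" using separated_small[OF S(2)] card_image[OF S(1)] by simp
next
  \<comment> \<open>A basis is obtained by lifting two points of a block and one point off
    it.\<close>
  obtain B where B: "B \<in> P" using two_blocks by metis
  obtain p q where pq: "p \<in> B" "q \<in> B" "p \<noteq> q" using block_two_points B by metis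
  obtain x where x: "x \<in> cosets L" "x \<notin> B" using point_off_block B by metis
  have "p \<in> cosets L" "q \<in> cosets L" using pq block_subset[OF B] by (metis subsetD)+
  then obtain a b c where abc: "p = pr a" "q = pr b" "x = pr c"
    using x(1) unfolding cosets_eq_range by (metis imageE)
  have ne: "pr a \<noteq> pr b" "pr c \<noteq> pr a" "pr c \<noteq> pr b" using pq x(2) abc by metis+
  then have "a \<noteq> b" "c \<noteq> a" "c \<noteq> b" by metis+
  then have "inj_on pr {a, b, c}" "card {a, b, c} = 3"
    using ne ne[symmetric] by (simp_all add: inj_on_def)
  moreover have "separated P (pr ` {a, b, c})"
    using separated_triple[OF B pq x] abc by simp
  ultimately show "\<exists>S. ul_indep J S \<and> finite S \<and> card S = 3"
    by (intro exI[of _ "{a, b, c}"]) (simp add: ul_indep_J_iff)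
qed

lemma ul_indep_J_pair_iff: "ul_indep J {a, b} \<longleftrightarrow> a = b \<or> pr a \<noteq> pr b"
  using separated_pair[OF pr_in pr_in, of a b] by (auto simp: ul_indep_J_iff)

lemma pair_in_J_iff:
  assumes "a \<noteq> b"
  shows "{a, b} \<in> J \<longleftrightarrow> pr a = pr b"
proof
  assume "{a, b} \<in> J"
  then have "\<not> ul_indep J {a, b}" unfolding ul_indep_def by (metis insert_not_empty order_refl)
  then show "pr a = pr b" using ul_indep_J_pair_iff by metis
next
  assume "pr a = pr b"
  then have "{a, b} - \<Union>B \<noteq> {w}" if "B \<in> P" for B w
    using assms spec[of _ a] spec[of _ b] spec[of _ w] unfolding Diff_Union_block_iff[OF that]
    by (metis insertCI insertE singletonD)
  then show "{a, b} \<in> J" unfolding J_def orthogonal_def by simp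
qed

lemma binomial_lattice_J: "binomial_lattice J = L"
proof -
  interpret tropical J by unfold_locales (rule tropical_ideal_J)
  have "a \<in> binomial_lattice J \<longleftrightarrow> a \<in> L" for a
    using binomial_lattice_iff[of a 0] coset_of_eq_iff[OF sublattice, of a 0] pair_in_J_iff[of a 0]
    by (cases "a = 0") (simp_all add: parallel_points_def)
  then show ?thesis by (rule set_eqI)
qed

lemma parallel_J_iff: "parallel (ul_indep J) a b \<longleftrightarrow> pr a = pr b"
proof (cases "a = b")
  case False
  have "ul_indep J {a}" "ul_indep J {b}"
    using ul_indep_J_pair_iff[of a a] ul_indep_J_pair_iff[of b b] by simp_all
  moreover have "{a, b} - {a} = {b}" "{a, b} - {b} = {a}" using False by auto
  ultimately show ?thesis
    using False by (simp add: parallel_def circuit_def ul_indep_J_pair_iff)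
qed (simp add: parallel_def)

lemma parallel_classes_J: "parallel_classes (ul_indep J) UNIV = cosets L"
proof -
  have "{b. pr a = pr b} = pr a" for a
    by (rule set_eqI) (simp only: mem_coset_of[OF sublattice] mem_Collect_eq eq_commute)
  then show ?thesis
    unfolding parallel_classes_def cosets_eq_range parallel_J_iff by (simp add: full_SetCompr_eq)
qed

text \<open>Every choice \<open>r\<close> of representatives is a section of \<open>pr\<close>, so
  \<open>pr\<close> r \<open>S = S\<close> and independence does not depend on the choice.\<close>

lemma si_indep_J_iff:
  assumes S: "S \<subseteq> cosets L"
  shows "si_indep (ul_indep J) UNIV S \<longleftrightarrow> separated P S"
proof -
  have mem: "pr x = c" if "c \<in> S" "x \<in> c" for x c
  proof -
    have "c \<in> cosets L" using S that(1) by (rule subsetD)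
    then obtain u where "c = pr u" by (rule cosetsE)
    then show ?thesis using that(2) mem_coset_of[OF sublattice] by simp
  qed
  have "inj_on r S \<and> ul_indep J (r ` S) \<longleftrightarrow> separated P S" if r: "\<forall>c\<in>S. r c \<in> c" for r
  proof -
    have id: "pr (r c) = c" if "c \<in> S" for c using r mem that by metis
    then have "pr ` r ` S = S" by (simp add: image_image)
    moreover have "inj_on r S" using id by (metis inj_onI)
    moreover have "inj_on pr (r ` S)" using id by (auto intro!: inj_onI)
    ultimately show ?thesis by (simp add: ul_indep_J_iff)
  qed
  moreover have "\<exists>r. \<forall>c\<in>S. r c \<in> c"
  proof (rule bchoice, rule ballI)
    fix c assume "c \<in> S"
    then obtain u where "c = pr u" using S by (meson cosetsE subsetD)
    then show "\<exists>x. x \<in> c" using mem_coset_of[OF sublattice] by metis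
  qed
  ultimately show ?thesis unfolding si_indep_def parallel_classes_J using S by metis
qed

lemma si_hyperplanes_J: "si_hyperplanes J = P"
  unfolding si_hyperplanes_def parallel_classes_J
  by (rule hyperplanes_eq_blocks[OF si_indep_J_iff])

end

section \<open>The lines of a tropical ideal of degree three\<close>

locale tropical_degree3 = tropical +
  assumes degree: "zero_dim_degree I 3"
begin

abbreviation pr where "pr \<equiv> coset_of (binomial_lattice I)"

text \<open>These are the flats of rank two, hence the hyperplanes in rank three.\<close>

definition lines :: "'a set set" where
  "lines = {cl {p, q} | p q. \<not> parallel_points p q}"

lemma obtain_basis:
  obtains S where "ul_indep I S" "finite S" "card S = 3"
  using degree unfolding zero_dim_degree_def by metis

lemma ul_indep_finite: "ul_indep I S \<Longrightarrow> finite S"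
  and ul_indep_card: "ul_indep I S \<Longrightarrow> card S \<le> 3"
  using degree unfolding zero_dim_degree_def by simp_all

text \<open>Translation would make every point a loop, and then no set of three points is
  independent.\<close>

lemma singleton_not_vector: "{u} \<notin> I"
proof
  assume "{u} \<in> I"
  then have all: "{v} \<in> I" for v using vector_translate[of "{u}" "v - u"] by simp
  obtain S where S: "ul_indep I S" "card S = 3" by (rule obtain_basis)
  then obtain v where "v \<in> S" by fastforce
  then have "{v} \<subseteq> S" by simp
  then show False using S(1) all[of v] unfolding ul_indep_def by (metis insert_not_empty)
qed

lemma ul_indep_singleton: "ul_indep I {x}"
  unfolding ul_indep_def using singleton_not_vector by (metis subset_singletonD)

lemma ul_indep_pair_iff: "ul_indep I {p, q} \<longleftrightarrow> p = q \<or> \<not> parallel_points p q"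
proof (cases "p = q")
  case False
  have "ul_indep I {p, q} \<longleftrightarrow> {p, q} \<notin> I"
  proof
    show "{p, q} \<notin> I" if "ul_indep I {p, q}"
      using that unfolding ul_indep_def by (metis insert_not_empty order_refl)
  next
    assume pq: "{p, q} \<notin> I"
    have "f = {} \<or> f = {p} \<or> f = {q} \<or> f = {p, q}" if "f \<subseteq> {p, q}" for f
      using that by (cases "p \<in> f"; cases "q \<in> f") auto
    then show "ul_indep I {p, q}"
      unfolding ul_indep_def using pq singleton_not_vector by metis
  qed
  then show ?thesis using False by (simp add: parallel_points_def)
qed (simp add: ul_indep_singleton)

lemma not_in_closure_of_small:
  assumes "finite A" "card A < 3"
  shows "\<exists>z. z \<notin> cl A"
proof (rule ccontr)
  assume "\<not> ?thesis"
  then have all: "S \<subseteq> cl A" for S by auto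
  obtain S where "ul_indep I S" "finite S" "card S = 3" by (rule obtain_basis)
  then show False using steinitz[of A S] assms all by simp
qed

lemma closure_pair_eq:
  assumes xy: "x \<in> cl {p, q}" "y \<in> cl {p, q}" "\<not> parallel_points x y"
  shows "cl {x, y} = cl {p, q}"
proof (rule subset_antisym)
  show sub: "cl {x, y} \<subseteq> cl {p, q}" by (rule closure_least) (simp add: xy)
  have ne: "x \<noteq> y" using xy(3) by (auto simp: parallel_points_def)
  have "z \<in> cl {x, y}" if z: "z \<in> {p, q}" for z
  proof (rule ccontr)
    \<comment> \<open>Three independent points in the closure of two would contradict
      \<open>steinitz\<close>.\<close>
    assume nz: "z \<notin> cl {x, y}"
    have "ul_indep I {x, y}" using xy(3) by (simp add: ul_indep_pair_iff)
    then have "ul_indep I {z, x, y}" using nz by (rule ul_indep_insert)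
    moreover have "z \<in> cl {p, q}" using z by (rule in_ul_closure)
    ultimately have "card {z, x, y} \<le> card {p, q}" using xy by (intro steinitz) simp_all
    moreover have "z \<noteq> x" "z \<noteq> y" using nz in_ul_closure by (metis insertCI)+
    then have "card {z, x, y} = 3" using ne by simp
    moreover have "card {p, q} \<le> 2" by (simp add: card_insert_if)
    ultimately show False by simp
  qed
  then show "cl {p, q} \<subseteq> cl {x, y}" by (intro closure_least) (rule subsetI)
qed

lemma closure_parallel:
  assumes "x \<in> cl S" "parallel_points x y"
  shows "y \<in> cl S"
proof (cases "x = y")
  case False
  then have "{x, y} \<in> I" using assms(2) by (simp add: parallel_points_def)
  then have "y \<in> cl (cl S)" using assms(1) by (intro ul_closureI[of "{x, y}"]) simp_all
  then show ?thesis by (simp add: closure_idem)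
qed (use assms in simp)

lemma closure_translate_subset: "(\<lambda>x. t + x) ` cl S \<subseteq> cl ((\<lambda>x. t + x) ` S)"
proof
  fix y assume "y \<in> (\<lambda>x. t + x) ` cl S"
  then obtain x where x: "x \<in> cl S" "y = t + x" by (rule imageE) simp
  show "y \<in> cl ((\<lambda>x. t + x) ` S)"
  proof (cases "x \<in> S")
    case True
    then show ?thesis using x by (intro in_ul_closure) simp
  next
    case False
    obtain f where f: "f \<in> I" "x \<in> f" "f \<subseteq> insert x S" using x(1) False by (rule ul_closureE)
    then have "(\<lambda>x. t + x) ` f \<subseteq> insert y ((\<lambda>x. t + x) ` S)"
      using image_mono[OF f(3), of "\<lambda>x. t + x"] x(2) by simp
    then show ?thesis using vector_translate[OF f(1), of t] f(2) x(2)
      by (intro ul_closureI[of "(\<lambda>x. t + x) ` f"]) simp_all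
  qed
qed

lemma closure_translate: "(\<lambda>x. t + x) ` cl S = cl ((\<lambda>x. t + x) ` S)"
proof (rule subset_antisym)
  have "(\<lambda>x. - t + x) ` cl ((\<lambda>x. t + x) ` S) \<subseteq> cl S"
    using closure_translate_subset[of "- t" "(\<lambda>x. t + x) ` S"] by (simp add: image_image)
  then have "(\<lambda>x. t + x) ` (\<lambda>x. - t + x) ` cl ((\<lambda>x. t + x) ` S) \<subseteq> (\<lambda>x. t + x) ` cl S"
    by (rule image_mono)
  then show "cl ((\<lambda>x. t + x) ` S) \<subseteq> (\<lambda>x. t + x) ` cl S" by (simp add: image_image)
qed (rule closure_translate_subset)

lemma lines_translate:
  assumes "H \<in> lines"
  shows "(\<lambda>x. t + x) ` H \<in> lines"
proof -
  obtain p q where pq: "H = cl {p, q}" "\<not> parallel_points p q"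
    using assms unfolding lines_def by blast
  have "\<not> parallel_points (t + p) (t + q)"
    using pq(2) parallel_points_translate[of "t + p" "t + q" "- t"] by auto
  moreover have "(\<lambda>x. t + x) ` H = cl {t + p, t + q}" by (simp add: pq(1) closure_translate)
  ultimately show ?thesis unfolding lines_def by blast
qed

text \<open>\<open>B\<close> is enlarged one point at a time to an independent pair, keeping
  \<open>w\<close> out of its closure.\<close>

lemma line_off_point_small:
  assumes "ul_indep I B" "w \<notin> cl B" "card B \<le> 2"
  shows "\<exists>H\<in>lines. B \<subseteq> H \<and> w \<notin> H"
  using assms
proof (induction "2 - card B" arbitrary: B)
  case 0
  then have "card B = 2" by simp
  then obtain p q where pq: "B = {p, q}" "p \<noteq> q" by (auto simp: card_2_iff)
  then have "\<not> parallel_points p q" using 0(2) by (simp add: ul_indep_pair_iff)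
  then have "cl B \<in> lines" using pq(1) unfolding lines_def by blast
  then show ?case using 0(3) subset_ul_closure by metis
next
  case (Suc n)
  have "w \<notin> B" using Suc.prems(2) in_ul_closure by metis
  have fin: "finite B" using Suc.prems(1) by (rule ul_indep_finite)
  then have "card (insert w B) < 3" using Suc.hyps(2) \<open>w \<notin> B\<close> by simp
  \<comment> \<open>Choosing \<open>z\<close> outside the closure with \<open>w\<close> added lets
    exchange keep \<open>w\<close> out of the closure with \<open>z\<close> added.\<close>
  then obtain z where z: "z \<notin> cl (insert w B)" using not_in_closure_of_small fin by (metis finite_insert)
  then have w: "w \<notin> cl (insert z B)" using ul_closure_exchange[OF _ Suc.prems(2)] by metis
  have zB: "z \<notin> cl B" using z ul_closure_mono[OF subset_insertI] by (metis subsetD)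
  have "z \<notin> B" using zB in_ul_closure by metis
  then have c: "card (insert z B) = Suc (card B)" using fin by simp
  have "\<exists>H\<in>lines. insert z B \<subseteq> H \<and> w \<notin> H"
    using Suc.hyps(2) c by (intro Suc.hyps(1) ul_indep_insert Suc.prems(1) zB w) simp_all
  then show ?case by (metis insert_subset)
qed

lemma line_off_point:
  assumes w: "w \<notin> cl T"
  shows "\<exists>H\<in>lines. T \<subseteq> H \<and> w \<notin> H"
proof -
  let ?B = "\<lambda>B. B \<subseteq> T \<and> ul_indep I B"
  have "?B {}" by (simp add: ul_indep_def)
  \<comment> \<open>The rank bounds independent subsets of the possibly infinite \<open>T\<close>,
    so a largest one exists; it spans \<open>T\<close>. As \<open>w\<close> is independent of it, it
    has at most two points.\<close>
  moreover have "\<forall>B. ?B B \<longrightarrow> card B < 4" using ul_indep_card by fastforce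
  ultimately obtain B where B: "B \<subseteq> T" "ul_indep I B" and max: "\<And>C. ?B C \<Longrightarrow> card C \<le> card B"
    using ex_has_greatest_nat[of ?B "{}" card 4] by metis
  have fin: "finite B" using B(2) by (rule ul_indep_finite)
  have "t \<in> cl B" if "t \<in> T" for t
  proof (rule ccontr)
    assume t: "t \<notin> cl B"
    then have "card (insert t B) \<le> card B" using B that by (intro max conjI ul_indep_insert) simp_all
    moreover have "t \<notin> B" using t in_ul_closure by metis
    ultimately show False using fin by simp
  qed
  then have T: "T \<subseteq> cl B" by (rule subsetI)
  have wB: "w \<notin> cl B" using w ul_closure_mono[OF B(1)] by (metis subsetD)
  then have "w \<notin> B" using in_ul_closure by metis
  have "card (insert w B) \<le> 3" by (rule ul_indep_card[OF ul_indep_insert[OF B(2) wB]])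
  then have "card B \<le> 2" using fin \<open>w \<notin> B\<close> by simp
  then obtain H where H: "H \<in> lines" "B \<subseteq> H" "w \<notin> H" using line_off_point_small[OF B(2) wB] by metis
  then obtain p q where "H = cl {p, q}" unfolding lines_def by blast
  then have "T \<subseteq> H" using T closure_least[of B "{p, q}"] H(2) by (metis subset_trans)
  then show ?thesis using H by metis
qed

text \<open>A vector leaving a line at only one point would put that point into the closed line.
  Conversely, a point \<open>w\<close> of \<open>f\<close> on no vector inside \<open>f\<close> is
  outside \<open>cl (f - {w})\<close>, and a line then isolates it; so an orthogonal
  \<open>f\<close> is a finite union of vectors.\<close>

lemma orthogonal_lines: "orthogonal lines = I"
proof (intro subset_antisym subsetI)
  fix f assume f: "f \<in> I"
  have "f - H \<noteq> {w}" if line: "H \<in> lines" for H w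
  proof
    assume eq: "f - H = {w}"
    obtain p q where H: "H = cl {p, q}" using line unfolding lines_def by blast
    have "w \<in> f - H" using eq by simp
    moreover have "f \<subseteq> insert w H" using eq by (metis Diff_subset_conv Un_insert_right sup_bot.right_neutral order_refl)
    ultimately have "w \<in> cl H" "w \<notin> H" using f ul_closureI by (metis DiffE)+
    then show False by (simp add: H closure_idem)
  qed
  then show "f \<in> orthogonal lines" using finite_vector[OF f] by (simp add: orthogonal_def)
next
  fix f assume f: "f \<in> orthogonal lines"
  have "\<exists>g\<in>I. w \<in> g \<and> g \<subseteq> f" if w: "w \<in> f" for w
  proof (rule ccontr)
    assume no: "\<not> ?thesis"
    have "w \<notin> cl (f - {w})"
    proof
      assume "w \<in> cl (f - {w})"
      then obtain g where "g \<in> I" "w \<in> g" "g \<subseteq> insert w (f - {w})" by (rule ul_closureE) simp_all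
      then show False using no w by (simp add: insert_absorb)
    qed
    then obtain H where H: "H \<in> lines" "f - {w} \<subseteq> H" "w \<notin> H" using line_off_point by metis
    then have "f - H = {w}" using w by auto
    then show False using f H(1) by (simp add: orthogonal_def)
  qed
  then have "f = \<Union>{g \<in> I. g \<subseteq> f}" by auto
  moreover have "finite f" using f by (simp add: orthogonal_def)
  then have "finite {g \<in> I. g \<subseteq> f}" by simp
  ultimately show "f \<in> I" using vector_Union[of "{g \<in> I. g \<subseteq> f}"] by auto
qed

section \<open>The two-partition formed by the lines\<close>

lemma pr_eq_iff: "pr x = pr y \<longleftrightarrow> parallel_points x y"
  using coset_of_eq_iff[OF sublattice_binomial_lattice] binomial_lattice_iff by metis

definition blocks :: "'a set set set" where
  "blocks = (\<lambda>H. pr ` H) ` lines"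

text \<open>Closed sets are unions of parallel classes, so lines are saturated for
  \<open>pr\<close>.\<close>

lemma pr_mem_line_iff:
  assumes "H \<in> lines"
  shows "pr x \<in> pr ` H \<longleftrightarrow> x \<in> H"
proof
  assume "pr x \<in> pr ` H"
  then obtain y where y: "y \<in> H" "pr y = pr x" by (metis imageE)
  obtain p q where "H = cl {p, q}" using assms unfolding lines_def by blast
  then show "x \<in> H" using y closure_parallel pr_eq_iff by metis
qed simp

lemma pr_image_subset: "pr ` H \<subseteq> cosets (binomial_lattice I)"
  unfolding cosets_eq_range by (rule image_mono) simp

lemma Union_blocks: "Union ` blocks = lines"
proof -
  have "\<Union>(pr ` H) = H" if "H \<in> lines" for H
    using mem_Union_cosets[OF sublattice_binomial_lattice pr_image_subset, of _ H]
      pr_mem_line_iff[OF that] by (intro set_eqI) metis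
  then show ?thesis unfolding blocks_def image_image by simp
qed

lemma two_partition_blocks: "two_partition (cosets (binomial_lattice I)) blocks"
  unfolding two_partition_def
proof (intro conjI ballI impI)
  fix B assume "B \<in> blocks"
  then obtain H where H: "B = pr ` H" "H \<in> lines" unfolding blocks_def by (rule imageE)
  show "B \<subseteq> cosets (binomial_lattice I)" unfolding H(1) by (rule pr_image_subset)
  obtain p q where pq: "H = cl {p, q}" "\<not> parallel_points p q" using H(2) unfolding lines_def by blast
  have "p \<in> H" "q \<in> H" unfolding pq(1) by (simp_all add: in_ul_closure)
  then show "\<exists>x\<in>B. \<exists>y\<in>B. x \<noteq> y" unfolding H(1) using pq(2) pr_eq_iff by (metis imageI)
next
  \<comment> \<open>The two blocks come from a line \<open>H\<close> avoiding \<open>w\<close> and a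
    line joining \<open>w\<close> to a point of \<open>H\<close>.\<close>
  obtain w where w: "w \<notin> cl {}" using not_in_closure_of_small[of "{}"] by auto
  then obtain H where H: "H \<in> lines" "w \<notin> H" using line_off_point by metis
  obtain p q where "H = cl {p, q}" using H(1) unfolding lines_def by blast
  then have p: "p \<in> H" by (simp add: in_ul_closure)
  have np: "\<not> parallel_points w p"
    using p H(2) pr_mem_line_iff[OF H(1)] pr_eq_iff by (metis imageI)
  then have "cl {w, p} \<in> lines" "w \<in> cl {w, p}" unfolding lines_def by (blast, simp add: in_ul_closure)
  then have "pr ` cl {w, p} \<in> blocks" "pr w \<in> pr ` cl {w, p}" unfolding blocks_def by simp_all
  moreover have "pr ` H \<in> blocks" "pr w \<notin> pr ` H"
    using H pr_mem_line_iff unfolding blocks_def by simp_all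
  ultimately show "\<exists>B1\<in>blocks. \<exists>B2\<in>blocks. B1 \<noteq> B2" by metis
next
  fix a b assume ab: "a \<in> cosets (binomial_lattice I)" "b \<in> cosets (binomial_lattice I)" "a \<noteq> b"
  obtain x where x: "a = pr x" using ab(1) by (rule cosetsE)
  obtain y where y: "b = pr y" using ab(2) by (rule cosetsE)
  have np: "\<not> parallel_points x y" using ab(3) x y pr_eq_iff by metis
  have mem: "x \<in> cl {x, y}" "y \<in> cl {x, y}" by (simp_all add: in_ul_closure)
  show "\<exists>!B. B \<in> blocks \<and> a \<in> B \<and> b \<in> B"
  proof (rule ex1I[of _ "pr ` cl {x, y}"])
    have "cl {x, y} \<in> lines" using np unfolding lines_def by blast
    then show "pr ` cl {x, y} \<in> blocks \<and> a \<in> pr ` cl {x, y} \<and> b \<in> pr ` cl {x, y}"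
      using mem unfolding blocks_def x y by simp
  next
    fix B assume B: "B \<in> blocks \<and> a \<in> B \<and> b \<in> B"
    then obtain H where H: "B = pr ` H" "H \<in> lines" unfolding blocks_def by (metis imageE)
    then have "x \<in> H" "y \<in> H" using B pr_mem_line_iff[OF H(2)] unfolding x y by simp_all
    moreover obtain p q where "H = cl {p, q}" using H(2) unfolding lines_def by blast
    ultimately show "B = pr ` cl {x, y}" using closure_pair_eq np H(1) by metis
  qed
qed

lemma invariant_blocks: "invariant_collection blocks"
proof (rule invariant_collectionI)
  fix B t assume "B \<in> blocks"
  then obtain H where H: "B = pr ` H" "H \<in> lines" unfolding blocks_def by (rule imageE)
  have "translate_coset t ` B = pr ` (\<lambda>x. t + x) ` H"
    by (simp add: H(1) image_image translate_coset_of)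
  then show "translate_coset t ` B \<in> blocks"
    unfolding blocks_def using lines_translate[OF H(2)] by (metis imageI)
qed

text \<open>The blocks of \<open>I\<close> are fed into the inverse construction. It returns
  \<open>I\<close> by \<open>J_eq\<close>, so the hyperplanes of the simplification, already
  computed for \<open>J\<close>, are known for \<open>I\<close> too.\<close>

sublocale quotient: quotient_linear_space "binomial_lattice I" blocks
  by unfold_locales (rule two_partition_blocks sublattice_binomial_lattice invariant_blocks)+

lemma J_eq: "quotient.J = I"
  unfolding quotient.J_def Union_blocks by (rule orthogonal_lines)

end

section \<open>The two constructions are mutually inverse\<close>

theorem mainTheorem6:
  shows "bij_betw (\<lambda>I. (binomial_lattice I, si_hyperplanes I))
           {I :: (int ^ 'n) set set. tropical_ideal I \<and> zero_dim_degree I 3}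
           {(L, P). sublattice L \<and> two_partition (cosets L) P \<and> invariant_collection P}"
proof (rule bij_betw_byWitness[where f' = "\<lambda>(L, P). orthogonal (Union ` P)"])
  have left: "sublattice (binomial_lattice I) \<and>
      two_partition (cosets (binomial_lattice I)) (si_hyperplanes I) \<and>
      invariant_collection (si_hyperplanes I) \<and>
      orthogonal (Union ` si_hyperplanes I) = I"
    if "tropical_ideal I \<and> zero_dim_degree I 3" for I :: "(int ^ 'n) set set"
  proof -
    interpret tropical_degree3 I by unfold_locales (use that in simp_all)
    have "si_hyperplanes I = blocks" using quotient.si_hyperplanes_J unfolding J_eq .
    then show ?thesis
      using sublattice_binomial_lattice two_partition_blocks invariant_blocks J_eq
      unfolding quotient.J_def by simp
  qed
  show "\<forall>I\<in>{I :: (int ^ 'n) set set. tropical_ideal I \<and> zero_dim_degree I 3}.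
      (case (binomial_lattice I, si_hyperplanes I) of (L, P) \<Rightarrow> orthogonal (Union ` P)) = I"
    using left by simp
  show "(\<lambda>I. (binomial_lattice I, si_hyperplanes I)) `
      {I :: (int ^ 'n) set set. tropical_ideal I \<and> zero_dim_degree I 3}
      \<subseteq> {(L, P). sublattice L \<and> two_partition (cosets L) P \<and> invariant_collection P}"
    using left by auto
  have right: "tropical_ideal (orthogonal (Union ` P)) \<and> zero_dim_degree (orthogonal (Union ` P)) 3 \<and>
      binomial_lattice (orthogonal (Union ` P)) = L \<and> si_hyperplanes (orthogonal (Union ` P)) = P"
    if "sublattice L \<and> two_partition (cosets L) P \<and> invariant_collection P"
    for L :: "(int ^ 'n) set" and P
  proof -
    interpret quotient_linear_space L P by unfold_locales (use that in simp_all)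
    show ?thesis
      using tropical_ideal_J zero_dim_degree_J binomial_lattice_J si_hyperplanes_J
      unfolding J_def by simp
  qed
  then show "\<forall>a\<in>{(L, P). sublattice L \<and> two_partition (cosets L) P \<and> invariant_collection P}.
      (\<lambda>I. (binomial_lattice I :: (int ^ 'n) set, si_hyperplanes I)) (case a of (L, P) \<Rightarrow> orthogonal (Union ` P)) = a"
    by auto
  show "(\<lambda>(L, P). orthogonal (Union ` P)) `
      {(L, P). sublattice L \<and> two_partition (cosets L) P \<and> invariant_collection P}
      \<subseteq> {I :: (int ^ 'n) set set. tropical_ideal I \<and> zero_dim_degree I 3}"
    using right by auto
qed

end
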